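(* Let $n\ge 1$, let $p\in[-\infty,\infty]$ and let $q\in\mathbb{R}$ with $q\neq 0$. The $(p,q)$-relative distance $$\rho_{p,q}(x,y)=\frac{|x-y|}{A_p(|x|,|y|)^q},\qquad \rho_{p,q}(0,0):=0,$$ is a metric in $\mathbb{R}^n$ if and only if $0<q\le 1$ and $p\ge\max\{1-q,(2-q)/3\}$.
   Context: $|\cdot|$ is the Euclidean norm on $\mathbb{R}^n$. For $x,y\ge 0$ the power mean of order $p$ is $A_p(x,y)=\left(\frac{x^p+y^p}{2}\right)^{1/p}$ for $p\in\mathbb{R}\setminus\{0\}$, $A_0(x,y)=\sqrt{xy}$, $A_{-\infty}(x,y)=\min\{x,y\}$, $A_\infty(x,y)=\max\{x,y\}$, with the convention $A_p(x,0)=A_p(0,x)=0$ for $p\le 0$. A metric takes finite values in $[0,\infty)$. For $x\ne y$: if $q>0$ and $A_p(|x|,|y|)=0$, then $\rho_{p,q}(x,y)$ is infinite (so $\rho_{p,q}$ is not a metric); if $q<0$, then $\rho_{p,q}(x,y)=|x-y|\,A_p(|x|,|y|)^{-q}$. *)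

theory Defs
  imports "HOL-Analysis.Analysis"
begin

text \<open>
  Only meaningful for nonnegative arguments.  The guard for \<open>r < 0\<close> is needed because
  \<open>0 powr r = 0\<close> in HOL, so the formula alone would not vanish when one argument is 0.
\<close>
definition power_mean :: "ereal \<Rightarrow> real \<Rightarrow> real \<Rightarrow> real" where
  "power_mean p x y =
    (if p = \<infinity> then max x y
     else if p = -\<infinity> then min x y
     else if p = 0 then sqrt (x * y)
     else let r = real_of_ereal p in
       if r < 0 \<and> (x = 0 \<or> y = 0) then 0
       else ((x powr r + y powr r) / 2) powr (1 / r))"

text \<open>
  Extended-real valued: for \<open>q > 0\<close> the distance of distinct points is infinite where the power
  mean vanishes.  The case \<open>q = 0\<close> is not intended to be used.
\<close>
definition rel_dist :: "ereal \<Rightarrow> real \<Rightarrow> real ^ 'n \<Rightarrow> real ^ 'n \<Rightarrow> ereal" where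
  "rel_dist p q x y =
    (let A = power_mean p (norm x) (norm y) in
     if x = 0 \<and> y = 0 then 0
     else if q < 0 then ereal (norm (x - y) * A powr (- q))
     else if A = 0 then \<infinity>
     else ereal (norm (x - y) / A powr q))"

definition is_finite_metric :: "('a \<Rightarrow> 'a \<Rightarrow> ereal) \<Rightarrow> bool" where
  "is_finite_metric d \<longleftrightarrow>
    (\<forall>x y. \<bar>d x y\<bar> \<noteq> \<infinity>) \<and> Metric_space UNIV (\<lambda>x y. real_of_ereal (d x y))"

end

theory Submission
  imports Defs "HOL-Real_Asymp.Real_Asymp"
begin

text \<open>
  Sufficiency. On the norms, combining the triangle inequality with Ptolemy's inequality
  \<open>|x - y| |z| \<le> |x - z| |y| + |z - y| |x|\<close> reduces the claim to points \<open>0 \<le> a < c < b\<close> of a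
  half-line. There \<open>D a b = b powr (1 - q) - a powr (1 - q)\<close> is additive along \<open>a < c < b\<close>, so it
  suffices that the quotient of the relative distance by \<open>D\<close> decreases in \<open>b / a = exp (2 * u)\<close>.
  Its logarithmic derivative is nonpositive iff
  \<open>coth u \<le> (1 - r) * tanh (p * u) + r * coth (r * u)\<close> with \<open>r = 1 - q\<close>. The right-hand side
  increases in \<open>p\<close>, so only \<open>p = r\<close> (for \<open>r \<ge> 1/2\<close>) and \<open>p = (1 + r) / 3\<close> (for \<open>r \<le> 1/2\<close>) matter,
  and these become inequalities between values of \<open>sinh\<close>, proved coefficientwise. The cases
  \<open>q = 1\<close> and \<open>a = 0\<close> follow by continuity.

  Necessity. All obstructions lie on a line: \<open>p > 0\<close> since \<open>1\<close> and \<open>0\<close> have finite nonzero distance,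
  \<open>q > 0\<close> from \<open>-1, 0, 1\<close> or \<open>0, 1, 2\<close>, \<open>q \<le> 1\<close> from \<open>t, 1, 0\<close> with \<open>t\<close> small,
  \<open>p \<ge> 1 - q\<close> from \<open>0, t, 1\<close> as \<open>t\<close> tends to \<open>0\<close>, and \<open>p \<ge> (2 - q) / 3\<close> from the second-order
  behaviour at nearby points.
\<close>

subsection \<open>Hyperbolic inequalities\<close>

text \<open>Coefficientwise in the Taylor series: only odd \<open>n\<close> occur, and there
  \<open>m ^ n \<le> m\<close>.\<close>

lemma sinh_scale_le:
  fixes m u :: real
  assumes "0 \<le> m" "m \<le> 1" "0 \<le> u"
  shows "sinh (m * u) \<le> m * sinh u"
proof (rule sums_le[OF _ sinh_converges sums_mult[OF sinh_converges]])
  fix n :: nat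
  have "m ^ n \<le> m" if "odd n"
    using that assms power_decreasing[of 1 n m] by (cases n) auto
  then have "(m * u) ^ n \<le> m * u ^ n" if "odd n"
    using that assms by (simp add: power_mult_distrib mult_right_mono)
  then show "(if even n then 0 else (m * u) ^ n /\<^sub>R fact n)
      \<le> m * (if even n then 0 else u ^ n /\<^sub>R fact n)"
    by (simp add: field_simps divide_right_mono)
qed

lemma convex_on_power_nonneg: "convex_on {0::real..} (\<lambda>x. x ^ n)"
  by (cases "even n") (auto intro: convex_power_odd convex_on_subset[OF convex_power_even])

text \<open>The squares of \<open>2 - r\<close> and \<open>1 - 2 r\<close>, with weights proportional to \<open>r (2 - r)\<close> and
  \<open>1 - 2 r\<close>, have mean exactly \<open>(1 + r)\<^sup>2\<close>, so this is Jensen's inequality.\<close>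
lemma odd_power_combination:
  fixes r :: real
  assumes r: "0 \<le> r" "r \<le> 1/2"
  shows "(1 - r) * (1 + r) ^ (2*n+1) \<le> r * (2 - r) ^ (2*n+1) + (1 - 2*r) ^ (2*n+1)"
proof -
  \<comment> \<open>\<open>S\<close> is the sum of the weights \<open>r * (2 - r)\<close> and
    \<open>1 - 2*r\<close>; one factor of each odd power goes into the weight, leaving powers of
    squares.\<close>
  define S where "S = (1 - r) * (1 + r)"
  have S: "S > 0" using r by (auto simp: S_def)
  define l where "l = r * (2 - r) / S"
  have l': "1 - l = (1 - 2*r) / S"
    using S by (simp add: l_def field_simps) (simp add: S_def algebra_simps)
  have l: "0 \<le> l" "0 \<le> 1 - l"
    unfolding l' using r S by (auto simp: l_def)
  have Sl: "S * l = r * (2 - r)" "S * (1 - l) = 1 - 2*r"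
    unfolding l' using S by (auto simp: l_def)
  have "S * ((1 - l) * (1 - 2*r)\<^sup>2 + l * (2 - r)\<^sup>2) = S * (1 + r)\<^sup>2"
    unfolding distrib_left mult.assoc[symmetric] Sl
    by (simp add: S_def power2_eq_square algebra_simps)
  then have mean: "(1 - l) * (1 - 2*r)\<^sup>2 + l * (2 - r)\<^sup>2 = (1 + r)\<^sup>2"
    using S by simp
  have "((1 + r)\<^sup>2) ^ n \<le> (1 - l) * ((1 - 2*r)\<^sup>2) ^ n + l * ((2 - r)\<^sup>2) ^ n"
    using convex_onD[OF convex_on_power_nonneg, of l "(1 - 2*r)\<^sup>2" "(2 - r)\<^sup>2" n] l mean by simp
  then have "S * ((1 + r)\<^sup>2) ^ n \<le> S * ((1 - l) * ((1 - 2*r)\<^sup>2) ^ n + l * ((2 - r)\<^sup>2) ^ n)"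
    using S by simp
  also have "\<dots> = (1 - 2*r) * ((1 - 2*r)\<^sup>2) ^ n + r * (2 - r) * ((2 - r)\<^sup>2) ^ n"
    unfolding distrib_left mult.assoc[symmetric] Sl ..
  finally show ?thesis
    by (simp add: S_def power_mult[symmetric] mult.assoc add.commute)
qed

text \<open>Taylor coefficients again, now by \<open>odd_power_combination\<close>;
  \<open>coth_le_small\<close> uses it with \<open>w = 2 * u / 3\<close>.\<close>

lemma sinh_combination:
  fixes r w :: real
  assumes r: "0 \<le> r" "r \<le> 1/2" and w: "0 \<le> w"
  shows "(1 - r) * sinh ((1 + r) * w) \<le> r * sinh ((2 - r) * w) + sinh ((1 - 2*r) * w)"
proof (rule sums_le[OF _ sums_mult[OF sinh_converges] sums_add[OF sums_mult[OF sinh_converges] sinh_converges]])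
  fix n :: nat
  show "(1 - r) * (if even n then 0 else ((1 + r) * w) ^ n /\<^sub>R fact n) \<le>
        r * (if even n then 0 else ((2 - r) * w) ^ n /\<^sub>R fact n) +
        (if even n then 0 else ((1 - 2*r) * w) ^ n /\<^sub>R fact n)"
  proof (cases "even n")
    case False
    then obtain k where k: "n = 2*k+1" by (auto elim: oddE)
    have "((1 - r) * (1 + r) ^ n) * (w ^ n / fact n) \<le> (r * (2 - r) ^ n + (1 - 2*r) ^ n) * (w ^ n / fact n)"
      unfolding k by (rule mult_right_mono[OF odd_power_combination[OF r]]) (use w in auto)
    with False show ?thesis
      by (simp only: power_mult_distrib if_False) (simp add: field_simps)
  qed simp
qed

text \<open>With \<open>v = r * u\<close>, clearing denominators and doubling the argument
  \<open>v\<close> turns the claim into \<open>sinh (2 * v - u) \<le> (2*r - 1) * sinh u\<close>,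
  which is \<open>sinh_scale_le\<close> since \<open>1/2 \<le> r\<close>.\<close>

lemma coth_le_large:
  fixes r u :: real
  assumes r: "1/2 \<le> r" "r \<le> 1" and u: "0 < u"
  shows "cosh u / sinh u \<le> (1 - r) * tanh (r * u) + r * cosh (r * u) / sinh (r * u)"
proof -
  define v where "v = r * u"
  have v: "v > 0" using r u by (simp add: v_def)
  have "sinh (2 * v - u) \<le> (2*r - 1) * sinh u"
    using sinh_scale_le[of "2*r-1" u] r u by (simp add: v_def algebra_simps)
  then have "cosh u * sinh (2 * v) \<le> (cosh (2 * v) + (2*r - 1)) * sinh u"
    by (simp add: sinh_diff algebra_simps)
  moreover have "cosh (2 * v) = 1 + 2 * sinh v ^ 2"
    by (simp add: cosh_double cosh_square_eq)
  ultimately have "cosh u * (sinh v * cosh v) \<le> (sinh v ^ 2 + r) * sinh u"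
    unfolding sinh_double by (simp add: algebra_simps)
  also have "sinh v ^ 2 + r = (1 - r) * sinh v ^ 2 + r * cosh v ^ 2"
    by (simp add: cosh_square_eq algebra_simps)
  finally have "cosh u * (sinh v * cosh v) \<le> ((1 - r) * sinh v ^ 2 + r * cosh v ^ 2) * sinh u" .
  then have "cosh u / sinh u \<le> ((1 - r) * sinh v ^ 2 + r * cosh v ^ 2) / (sinh v * cosh v)"
    using u v by (simp add: divide_simps)
  also have "\<dots> = (1 - r) * tanh v + r * cosh v / sinh v"
    using v by (simp add: tanh_def field_simps power2_eq_square)
  finally show ?thesis by (simp add: v_def)
qed

text \<open>The choice of \<open>p\<close> makes \<open>u + v = 3 * y\<close>. Product-to-sum
  formulas turn the cleared inequality into \<open>sinh_combination\<close>, whose arguments become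
  \<open>u + v - y = 2 * y\<close>, \<open>u - v + y\<close> and \<open>u - v - y\<close>.\<close>

lemma coth_le_small:
  fixes r u :: real
  assumes r: "0 < r" "r \<le> 1/2" and u: "0 < u"
  defines "p \<equiv> (1 + r) / 3"
  shows "cosh u / sinh u \<le> (1 - r) * tanh (p * u) + r * cosh (r * u) / sinh (r * u)"
proof -
  define v where "v = r * u"
  define y where "y = p * u"
  have v: "v > 0" using r u by (simp add: v_def)
  have u_eq: "u = 3 * y - v" by (simp add: v_def y_def p_def field_simps)
  have "(1 - r) * sinh (2 * y) \<le> r * sinh (u - v + y) + sinh (u - v - y)"
    using sinh_combination[of r "2 * u / 3"] r u
    by (simp add: v_def y_def p_def field_simps)
  moreover have "2 * y = (u + v) - y" using u_eq by simp
  ultimately have "(1 - r) * sinh ((u + v) - y) \<le> r * sinh (u - v + y) + sinh (u - v - y)" by simp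
  moreover have "2 * (((1 - r) * sinh y * sinh v + r * cosh v * cosh y) * sinh u - cosh u * (sinh v * cosh y))
      = r * sinh (u - v + y) + sinh (u - v - y) - (1 - r) * sinh ((u + v) - y)"
    by (simp add: sinh_add sinh_diff cosh_add cosh_diff algebra_simps)
  ultimately have "cosh u * (sinh v * cosh y) \<le> ((1 - r) * sinh y * sinh v + r * cosh v * cosh y) * sinh u"
    by (smt (verit))
  then have "cosh u / sinh u \<le> ((1 - r) * sinh y * sinh v + r * cosh v * cosh y) / (sinh v * cosh y)"
    using u v by (simp add: divide_simps)
  also have "\<dots> = (1 - r) * tanh y + r * cosh v / sinh v"
    using v by (simp add: tanh_def field_simps)
  finally show ?thesis by (simp add: v_def y_def)
qed

lemma coth_le:
  fixes p r u :: real
  assumes r: "0 < r" "r < 1" and p: "r \<le> p" "(1 + r) / 3 \<le> p" and u: "0 < u"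
  shows "cosh u / sinh u \<le> (1 - r) * tanh (p * u) + r * cosh (r * u) / sinh (r * u)"
proof -
  have mono: "(1 - r) * tanh (p' * u) \<le> (1 - r) * tanh (p * u)" if "p' \<le> p" for p'
    using that r u by (simp add: mult_left_mono)
  show ?thesis
  proof (cases "r \<le> 1/2")
    case True
    show ?thesis using coth_le_small[OF r(1) True u] mono[OF p(2)] by linarith
  next
    case False
    then show ?thesis using coth_le_large[of r u] mono[OF p(1)] r u by linarith
  qed
qed

subsection \<open>The triangle inequality on the half-line\<close>

text \<open>For \<open>u = (ln b - ln a) / 2\<close> this is the relative distance of
  \<open>0 < a < b\<close> divided by \<open>b powr (1 - q) - a powr (1 - q)\<close>; see
  \<open>pos_rel_dist_eq_ratio\<close>.\<close>

definition hyp_ratio :: "real \<Rightarrow> real \<Rightarrow> real \<Rightarrow> real" where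
  "hyp_ratio p q u = sinh u / (cosh (p * u) powr (q / p) * sinh ((1 - q) * u))"

lemma hyp_ratio_antimono:
  fixes p q :: real
  assumes q: "0 < q" "q < 1" and p: "1 - q \<le> p" "(2 - q) / 3 \<le> p" and u: "0 < u" "u \<le> v"
  shows "hyp_ratio p q v \<le> hyp_ratio p q u"
proof -
  \<comment> \<open>The logarithm of the ratio; its derivative is nonpositive by
    \<open>coth_le\<close> at \<open>r = 1 - q\<close>, where \<open>(1 + r) / 3\<close> is
    \<open>(2 - q) / 3\<close>.\<close>
  define L where "L x = ln (sinh x) - q / p * ln (cosh (p * x)) - ln (sinh ((1 - q) * x))" for x
  have p0: "p > 0" using p q by linarith
  have exp_L: "hyp_ratio p q x = exp (L x)" if "x > 0" for x
    using that q by (simp add: L_def hyp_ratio_def exp_diff powr_def)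
  have "L v \<le> L u"
  proof (rule DERIV_nonpos_imp_nonincreasing[OF u(2)])
    fix x assume "u \<le> x"
    then have x: "x > 0" using u by simp
    have "(L has_real_derivative cosh x / sinh x - q * tanh (p * x)
        - (1 - q) * cosh ((1 - q) * x) / sinh ((1 - q) * x)) (at x)"
      unfolding L_def
      by (rule derivative_eq_intros refl | use x q p0 in \<open>force simp: tanh_def field_simps\<close>)+
    moreover have "cosh x / sinh x - q * tanh (p * x)
        - (1 - q) * cosh ((1 - q) * x) / sinh ((1 - q) * x) \<le> 0"
      using coth_le[of "1 - q" p x] p q x by simp
    ultimately show "\<exists>y. (L has_real_derivative y) (at x) \<and> y \<le> 0" by blast
  qed
  then show ?thesis using u by (simp add: exp_L)
qed

lemma sum_exp_eq: "exp a + exp b = 2 * exp ((a + b) / 2) * cosh ((b - a) / 2 :: real)"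
  by (simp add: cosh_def exp_add[symmetric] distrib_left diff_divide_distrib add_divide_distrib)

lemma diff_exp_eq: "exp b - exp a = 2 * exp ((a + b) / 2) * sinh ((b - a) / 2 :: real)"
  by (simp add: sinh_def exp_add[symmetric] right_diff_distrib diff_divide_distrib add_divide_distrib)

text \<open>The outer exponent \<open>1 / p\<close> of the mean and the exponent \<open>q\<close>
  are merged into \<open>q / p\<close>.\<close>

definition pos_rel_dist :: "real \<Rightarrow> real \<Rightarrow> real \<Rightarrow> real \<Rightarrow> real" where
  "pos_rel_dist p q a b = (b - a) / ((a powr p + b powr p) / 2) powr (q / p)"

text \<open>Logarithmic coordinates separate the geometric mean of the points, entering with the
  degree of homogeneity \<open>1 - q\<close>, from their ratio.\<close>

lemma pos_rel_dist_exp: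
  fixes p q a b :: real
  assumes "p \<noteq> 0"
  shows "pos_rel_dist p q (exp a) (exp b) =
    2 * exp ((1 - q) * (a + b) / 2) * sinh ((b - a) / 2) / cosh (p * ((b - a) / 2)) powr (q / p)"
proof -
  have "(exp a powr p + exp b powr p) / 2 = exp (p * (a + b) / 2) * cosh (p * ((b - a) / 2))"
    using sum_exp_eq[of "p * a" "p * b"] by (simp add: powr_def algebra_simps)
  then have "((exp a powr p + exp b powr p) / 2) powr (q / p) =
      exp (q * (a + b) / 2) * cosh (p * ((b - a) / 2)) powr (q / p)"
    using assms by (simp add: powr_mult) (simp add: powr_def)
  moreover have "exp ((1 - q) * (a + b) / 2) = exp ((a + b) / 2) / exp (q * (a + b) / 2)"
    by (simp add: exp_diff[symmetric] field_simps)
  ultimately show ?thesis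
    unfolding pos_rel_dist_def diff_exp_eq by simp
qed

lemma pos_rel_dist_eq_ratio:
  fixes p q a b :: real
  assumes "p \<noteq> 0" "q < 1" "a < b"
  shows "pos_rel_dist p q (exp a) (exp b) =
    (exp ((1 - q) * b) - exp ((1 - q) * a)) * hyp_ratio p q ((b - a) / 2)"
proof -
  have "exp ((1 - q) * b) - exp ((1 - q) * a) =
      2 * exp ((1 - q) * (a + b) / 2) * sinh ((1 - q) * ((b - a) / 2))"
    unfolding diff_exp_eq by (simp add: algebra_simps)
  moreover have "sinh ((1 - q) * ((b - a) / 2)) \<noteq> 0" using assms by simp
  ultimately show ?thesis
    unfolding pos_rel_dist_exp[OF assms(1)] hyp_ratio_def by (simp add: field_simps)
qed

lemma pos_rel_dist_triangle_strict:
  fixes p q a b c :: real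
  assumes q: "0 < q" "q < 1" and p: "1 - q \<le> p" "(2 - q) / 3 \<le> p"
    and abc: "0 < a" "a < c" "c < b"
  shows "pos_rel_dist p q a b \<le> pos_rel_dist p q a c + pos_rel_dist p q c b"
proof -
  define x y z where "x = ln a" and "y = ln b" and "z = ln c"
  have e: "a = exp x" "b = exp y" "c = exp z" using abc by (simp_all add: x_def y_def z_def)
  have xyz: "x < z" "z < y" using abc by (simp_all add: e)
  define D where "D s t = exp ((1 - q) * t) - exp ((1 - q) * s)" for s t
  have D: "D x z \<ge> 0" "D z y \<ge> 0" "D x y = D x z + D z y"
    using xyz q by (simp_all add: D_def)
  have p0: "p \<noteq> 0" using p q by linarith
  have eq: "pos_rel_dist p q (exp s) (exp t) = D s t * hyp_ratio p q ((t - s) / 2)" if "s < t" for s t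
    using pos_rel_dist_eq_ratio[OF p0 q(2) that] by (simp add: D_def)
  \<comment> \<open>The gap from \<open>x\<close> to \<open>y\<close> is the longest, so its ratio
    is the smallest; additivity of \<open>D\<close> finishes.\<close>
  have "D x z * hyp_ratio p q ((y - x) / 2) \<le> D x z * hyp_ratio p q ((z - x) / 2)"
    "D z y * hyp_ratio p q ((y - x) / 2) \<le> D z y * hyp_ratio p q ((y - z) / 2)"
    using xyz D by (auto intro!: mult_left_mono hyp_ratio_antimono q p)
  then show ?thesis
    using xyz D(3) by (simp add: e eq algebra_simps)
qed

text \<open>Limit of the strict case under \<open>p + e\<close>, \<open>q * (1 - e)\<close>,
  \<open>a + e\<close>: lowering \<open>q\<close> raises both lower bounds for \<open>p\<close> by
  at most \<open>e\<close>, because \<open>q \<le> 1\<close>.\<close>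

lemma pos_rel_dist_triangle:
  fixes p q a b c :: real
  assumes q: "0 < q" "q \<le> 1" and p: "1 - q \<le> p" "(2 - q) / 3 \<le> p"
    and abc: "0 \<le> a" "a < c" "c < b"
  shows "pos_rel_dist p q a b \<le> pos_rel_dist p q a c + pos_rel_dist p q c b"
proof -
  have p0: "p > 0" using p(2) q(2) by (simp add: field_simps)
  \<comment> \<open>\<open>k\<close> and \<open>l\<close> are 1 for an endpoint that moves with
    \<open>e\<close> and 0 for a fixed one; only \<open>a\<close> moves.\<close>
  have lim: "((\<lambda>e. pos_rel_dist (p + e) (q * (1 - e)) (s + e * k) (t + e * l)) \<longlongrightarrow>
      pos_rel_dist p q s t) (at_right 0)" if "0 \<le> s" "s < t" "k \<ge> 0" "l \<ge> 0" for s t k l :: real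
  proof -
    have "s powr p + t powr p > 0" using that by (intro add_nonneg_pos) auto
    then have "((\<lambda>e. pos_rel_dist (p + e) (q * (1 - e)) (s + e * k) (t + e * l)) \<longlongrightarrow>
      pos_rel_dist (p + 0) (q * (1 - 0)) (s + 0 * k) (t + 0 * l)) (at_right 0)"
      unfolding pos_rel_dist_def
      by (intro tendsto_intros)
        (use that p0 in \<open>auto intro!: add_nonneg_pos simp: eventually_at_filter\<close>)
    then show ?thesis by simp
  qed
  show ?thesis
  proof (rule tendsto_le[OF _ tendsto_add[OF lim[of a c 1 0] lim[of c b 0 0]] lim[of a b 1 0]])
    have "\<forall>\<^sub>F e in at_right 0. e \<in> {0<..<min 1 (c - a)}"
      using abc by (intro eventually_at_right_real) auto
    then show "\<forall>\<^sub>F e in at_right 0. pos_rel_dist (p + e) (q * (1 - e)) (a + e * 1) (b + e * 0)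
        \<le> pos_rel_dist (p + e) (q * (1 - e)) (a + e * 1) (c + e * 0)
          + pos_rel_dist (p + e) (q * (1 - e)) (c + e * 0) (b + e * 0)"
    proof eventually_elim
      case (elim e)
      have e: "0 < e" "e < 1" "a + e < c" using elim by auto
      have lt: "0 < q * e" using e q by simp
      have "q * e \<le> e" using e q mult_right_mono[of q 1 e] by simp
      then have "q * (1 - e) < 1" "1 - q * (1 - e) \<le> p + e" "2 - q * (1 - e) \<le> 3 * (p + e)"
        using p lt q by (simp_all add: right_diff_distrib)
      moreover have "0 < q * (1 - e)" using e q by simp
      ultimately show ?case
        using e abc by (intro pos_rel_dist_triangle_strict) (auto simp: pos_divide_le_eq)
    qed
  qed (use abc in auto)
qed

subsection \<open>From the half-line to inner product spaces\<close>

lemma norm_diff_inversion: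
  fixes x y :: "'a::real_inner"
  assumes "x \<noteq> 0" "y \<noteq> 0"
  shows "norm (x /\<^sub>R (norm x)\<^sup>2 - y /\<^sub>R (norm y)\<^sup>2) = norm (x - y) / (norm x * norm y)"
proof -
  have "(norm (x /\<^sub>R (norm x)\<^sup>2 - y /\<^sub>R (norm y)\<^sup>2))\<^sup>2 = (norm (x - y) / (norm x * norm y))\<^sup>2"
    using assms
    by (simp add: power2_norm_eq_inner power_divide power_mult_distrib inner_diff_left inner_diff_right
        inner_commute[of y x] divide_simps)
  then show ?thesis
    by (simp add: power2_eq_iff_nonneg)
qed

text \<open>The triangle inequality for the images under inversion in the unit sphere, multiplied by
  \<open>norm x * norm y * norm z\<close>.\<close>

lemma ptolemy_inequality:
  fixes x y z :: "'a::real_inner"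
  shows "norm (x - y) * norm z \<le> norm (x - z) * norm y + norm (z - y) * norm x"
proof (cases "x = 0 \<or> y = 0 \<or> z = 0")
  case False
  define I where "I v = v /\<^sub>R (norm v)\<^sup>2" for v :: 'a
  have "norm (I x - I y) \<le> norm (I x - I z) + norm (I z - I y)"
    using norm_triangle_ineq[of "I x - I z" "I z - I y"] by simp
  with False have "norm (x - y) / (norm x * norm y)
      \<le> norm (x - z) / (norm x * norm z) + norm (z - y) / (norm z * norm y)"
    by (simp add: I_def norm_diff_inversion)
  with False show ?thesis by (simp add: field_simps)
qed (auto simp: norm_minus_commute mult.commute)

text \<open>\<open>M\<close> stands for the \<open>q\<close>-th power of the mean. If
  \<open>norm z\<close> is at most both norms, \<open>mono\<close> and the triangle inequality
  suffice; if at least both, \<open>quot\<close> and Ptolemy; in between, \<open>line\<close> makes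
  a nonnegative combination of the two inequalities work.\<close>

lemma relative_triangle_ordered:
  fixes M :: "real \<Rightarrow> real \<Rightarrow> real" and x y z :: "'a::real_inner"
  assumes sym: "\<And>a b. M a b = M b a"
    and pos: "\<And>a b. 0 \<le> a \<Longrightarrow> 0 < b \<Longrightarrow> 0 < M a b"
    and mono: "\<And>a b c. 0 \<le> a \<Longrightarrow> 0 \<le> b \<Longrightarrow> b \<le> c \<Longrightarrow> M a b \<le> M a c"
    and quot: "\<And>a b c. 0 \<le> a \<Longrightarrow> 0 < b \<Longrightarrow> b \<le> c \<Longrightarrow> M a c * b \<le> M a b * c"
    and line: "\<And>a b c. 0 \<le> a \<Longrightarrow> a < c \<Longrightarrow> c < b \<Longrightarrow> (b - a) / M a b \<le> (c - a) / M a c + (b - c) / M c b"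
    and le: "norm x \<le> norm y"
  shows "norm (x - y) / M (norm x) (norm y)
    \<le> norm (x - z) / M (norm x) (norm z) + norm (z - y) / M (norm z) (norm y)"
proof (cases "x = y \<or> x = z \<or> z = y")
  case True
  have "0 \<le> norm (u - v) / M (norm u) (norm v)" for u v :: 'a
  proof (cases "v = 0")
    case True
    then show ?thesis using pos[of 0 "norm u"] sym[of "norm u" 0] by (cases "u = 0") auto
  next
    case False
    then show ?thesis using pos[of "norm u" "norm v"] by simp
  qed
  with True show ?thesis by (auto intro: add_nonneg_nonneg)
next
  case False
  define a b c P Q R where "a = norm x" and "b = norm y" and "c = norm z"
    and "P = norm (x - y)" and "Q = norm (x - z)" and "R = norm (z - y)"
  note defs = this
  have nn: "0 \<le> a" "0 \<le> b" "0 \<le> c" "0 \<le> P" "0 \<le> Q" "0 \<le> R" by (simp_all add: defs)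
  have tri: "P \<le> Q + R" using norm_triangle_ineq[of "x - z" "z - y"] by (simp add: defs)
  have ptol: "P * c \<le> Q * b + R * a" unfolding defs by (rule ptolemy_inequality)
  have ab: "a \<le> b" using le by (simp add: defs)
  have b0: "0 < b" using ab False by (auto simp: defs)
  have "0 < c \<or> 0 < a" using False by (auto simp: defs)
  then have Mpos: "0 < M a b" "0 < M a c" "0 < M c b"
    using pos[of a b] pos[of a c] pos[of c a] pos[of c b] sym[of a c] nn b0 by auto
  have "P / M a b \<le> Q / M a c + R / M c b"
  proof (cases "c \<le> a")
    case True
    have "Q / M a b \<le> Q / M a c" "R / M a b \<le> R / M c b"
      using True ab nn Mpos mono[of a c b] mono[of b c a] sym[of b]
      by (auto intro!: divide_left_mono)
    moreover have "P / M a b \<le> Q / M a b + R / M a b"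
      using tri Mpos by (simp add: divide_right_mono flip: add_divide_distrib)
    ultimately show ?thesis by linarith
  next
    case ca: False
    show ?thesis
    proof (cases "b \<le> c")
      case True
      have c0: "0 < c" using True b0 by simp
      have "M a c * b \<le> M a b * c" using quot[of a b c] nn b0 True by simp
      then have "Q * (M a c * b) \<le> Q * (M a b * c)" using nn by (simp add: mult_left_mono)
      then have 1: "Q * b / (c * M a b) \<le> Q / M a c"
        using Mpos c0 by (simp add: divide_simps mult_ac)
      have "M b c * a \<le> M b a * c" using quot[of b a c] nn ca by (cases "a = 0") (auto simp: pos less_imp_le b0 sym[of b])
      then have "R * (M b c * a) \<le> R * (M b a * c)" using nn by (simp add: mult_left_mono)
      then have 2: "R * a / (c * M a b) \<le> R / M c b"
        using Mpos c0 by (simp add: divide_simps mult_ac sym[of b])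
      have "P / M a b = P * c / (c * M a b)" using c0 by simp
      also have "\<dots> \<le> (Q * b + R * a) / (c * M a b)"
        using ptol c0 Mpos by (intro divide_right_mono) auto
      finally show ?thesis using 1 2 by (simp add: add_divide_distrib)
    next
      case False
      define \<alpha> \<beta> where "\<alpha> = M a b / M a c" and "\<beta> = M a b / M c b"
      have "M a c \<le> M a b" "M a b * c \<le> M a c * b" using mono[of a c b] quot[of a c b] False ca nn by auto
      then have \<alpha>: "1 \<le> \<alpha>" "\<alpha> * c \<le> b"
        using Mpos by (auto simp: \<alpha>_def divide_simps mult_ac)
      have "(b - a) / M a b * M a b \<le> ((c - a) / M a c + (b - c) / M c b) * M a b"
        using line[of a c b] False ca nn Mpos by (intro mult_right_mono) auto
      then have \<beta>: "b - a \<le> \<alpha> * (c - a) + \<beta> * (b - c)"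
        using Mpos by (simp add: \<alpha>_def \<beta>_def distrib_left mult.commute)
      text \<open>The pairs \<open>(1, 1)\<close> and \<open>(b / c, a / c)\<close> of coefficients, given by the triangle and
        Ptolemy inequalities, span the line on which \<open>b - a = \<alpha> * (c - a) + \<beta> * (b - c)\<close>.\<close>
      have "(b - c) * P = (b - \<alpha> * c) * P + (\<alpha> - 1) * (P * c)" by (simp add: algebra_simps)
      also have "\<dots> \<le> (b - \<alpha> * c) * (Q + R) + (\<alpha> - 1) * (Q * b + R * a)"
        using \<alpha> tri ptol by (intro add_mono mult_left_mono) auto
      also have "\<dots> = (b - c) * (\<alpha> * Q) + (b - a - \<alpha> * (c - a)) * R" by (simp add: algebra_simps)
      also have "\<dots> \<le> (b - c) * (\<alpha> * Q) + (\<beta> * (b - c)) * R"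
        using \<beta> nn by (intro add_left_mono mult_right_mono) auto
      finally have "(b - c) * P \<le> (b - c) * (\<alpha> * Q + \<beta> * R)" by (simp add: algebra_simps)
      then have "P \<le> \<alpha> * Q + \<beta> * R" using False by simp
      then show ?thesis
        using Mpos by (simp add: \<alpha>_def \<beta>_def divide_simps mult_ac) (simp add: algebra_simps)
    qed
  qed
  then show ?thesis by (simp add: defs)
qed

lemma relative_triangle:
  fixes M :: "real \<Rightarrow> real \<Rightarrow> real" and x y z :: "'a::real_inner"
  assumes sym: "\<And>a b. M a b = M b a"
    and pos: "\<And>a b. 0 \<le> a \<Longrightarrow> 0 < b \<Longrightarrow> 0 < M a b"
    and mono: "\<And>a b c. 0 \<le> a \<Longrightarrow> 0 \<le> b \<Longrightarrow> b \<le> c \<Longrightarrow> M a b \<le> M a c"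
    and quot: "\<And>a b c. 0 \<le> a \<Longrightarrow> 0 < b \<Longrightarrow> b \<le> c \<Longrightarrow> M a c * b \<le> M a b * c"
    and line: "\<And>a b c. 0 \<le> a \<Longrightarrow> a < c \<Longrightarrow> c < b \<Longrightarrow> (b - a) / M a b \<le> (c - a) / M a c + (b - c) / M c b"
  shows "norm (x - y) / M (norm x) (norm y)
    \<le> norm (x - z) / M (norm x) (norm z) + norm (z - y) / M (norm z) (norm y)"
proof (cases "norm x \<le> norm y")
  case True
  show ?thesis by (rule relative_triangle_ordered[OF sym pos mono quot line True])
next
  case False
  then have "norm y \<le> norm x" by simp
  from relative_triangle_ordered[OF sym pos mono quot line this, of z]
  show ?thesis
    by (simp add: norm_minus_commute[of y] norm_minus_commute[of z x] sym[of "norm y"] sym[of "norm z" "norm x"] add.commute)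
qed

subsection \<open>Necessary conditions on the exponents\<close>

text \<open>The second term drops below 1 linearly in \<open>y\<close>, while
  \<open>y powr e\<close> is of smaller order.\<close>

lemma powr_sum_less_one_near_zero:
  "1 < e \<Longrightarrow> 0 < s \<Longrightarrow> \<forall>\<^sub>F y::real in at_right 0. y powr e + (1 + y) powr (- s) < 1"
  by real_asymp

text \<open>With \<open>t = y powr (1 / p)\<close> and \<open>2 powr (q / p)\<close> cancelled, the
  inequality bounds 1 by a sum that \<open>powr_sum_less_one_near_zero\<close> puts below 1 if
  \<open>(1 - q) / p > 1\<close>.\<close>

lemma pos_rel_dist_triangle_imp_first_exponent:
  fixes p q :: real
  assumes p: "0 < p" and q: "0 < q"
    and tri: "\<And>t. 0 < t \<Longrightarrow> t < 1 \<Longrightarrow> pos_rel_dist p q 0 1 \<le> pos_rel_dist p q 0 t + pos_rel_dist p q t 1"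
  shows "1 - q \<le> p"
proof (rule ccontr)
  assume "\<not> 1 - q \<le> p"
  then have "1 < (1 - q) / p" "0 < q / p" using p q by (auto simp: field_simps)
  then have "\<forall>\<^sub>F y in at_right 0. y powr ((1 - q) / p) + (1 + y) powr (- (q / p)) < 1"
    by (rule powr_sum_less_one_near_zero)
  moreover have "\<forall>\<^sub>F y::real in at_right 0. y \<in> {0<..<1}"
    by (intro eventually_at_right_real) auto
  ultimately have "\<forall>\<^sub>F y in at_right (0::real). False"
  proof eventually_elim
    case (elim y)
    define t where "t = y powr (1 / p)"
    define K where "K = 2 powr (q / p)"
    have K: "K > 0" by (simp add: K_def)
    have t: "0 < t" "t < 1" "t powr p = y"
      using elim p powr_less_mono2[of "1 / p" y 1] by (auto simp: t_def powr_powr)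
    have "pos_rel_dist p q 0 1 = K"
      by (simp add: pos_rel_dist_def powr_divide K_def)
    moreover have "pos_rel_dist p q 0 t = K * y powr ((1 - q) / p)"
    proof -
      have "pos_rel_dist p q 0 t = K * (t / t powr q)"
        using t(1,2) p by (simp add: pos_rel_dist_def powr_divide powr_powr K_def)
      also have "t / t powr q = t powr (1 - q)" using t by (simp add: powr_diff)
      finally show ?thesis by (simp add: t_def powr_powr)
    qed
    moreover have "pos_rel_dist p q t 1 = K * ((1 - t) * (1 + y) powr (- (q / p)))"
      using t elim by (simp add: pos_rel_dist_def powr_divide K_def powr_minus field_simps)
    ultimately have "1 \<le> y powr ((1 - q) / p) + (1 - t) * (1 + y) powr (- (q / p))"
      using tri[OF t(1,2)] K by (simp flip: distrib_left)
    also have "(1 - t) * (1 + y) powr (- (q / p)) \<le> 1 * (1 + y) powr (- (q / p))"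
      using t by (intro mult_right_mono) auto
    finally show False using elim by simp
  qed
  then show False by simp
qed

lemma ln_cosh_over_square_tendsto:
  "((\<lambda>w::real. ln (cosh (k * w)) / w\<^sup>2) \<longlongrightarrow> k\<^sup>2 / 2) (at_right 0)"
proof (cases "k = 0")
  case False
  have "((\<lambda>w::real. ln (cosh w) / w\<^sup>2) \<longlongrightarrow> 1 / 2) (at_right 0)"
    unfolding cosh_field_def by real_asymp
  \<comment> \<open>The absolute value keeps the rescaled variable positive; \<open>cosh\<close> is
    even.\<close>
  moreover have "filterlim (\<lambda>w. \<bar>k\<bar> * w) (at_right 0) (at_right 0)"
    using False by real_asymp
  ultimately have "((\<lambda>w::real. ln (cosh (\<bar>k\<bar> * w)) / (\<bar>k\<bar> * w)\<^sup>2) \<longlongrightarrow> 1 / 2) (at_right 0)"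
    by (rule filterlim_compose)
  then have "((\<lambda>w::real. k\<^sup>2 * (ln (cosh (\<bar>k\<bar> * w)) / (\<bar>k\<bar> * w)\<^sup>2)) \<longlongrightarrow> k\<^sup>2 * (1 / 2)) (at_right 0)"
    by (rule tendsto_mult_left)
  moreover have "cosh (\<bar>k\<bar> * w) = cosh (k * w)" for w
    by (cases "k \<ge> 0") auto
  ultimately show ?thesis
    using False by (simp add: power_mult_distrib)
qed simp

text \<open>Second-order expansion of the triangle inequality for \<open>exp (- 2 w), 1, exp (2 w)\<close> as
  \<open>w\<close> tends to \<open>0\<close>.\<close>
lemma pos_rel_dist_triangle_imp_second_exponent:
  fixes p q :: real
  assumes p: "0 < p" and q: "0 < q"
    and tri: "\<And>w. 0 < w \<Longrightarrow> pos_rel_dist p q (exp (-2*w)) (exp (2*w))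
      \<le> pos_rel_dist p q (exp (-2*w)) 1 + pos_rel_dist p q 1 (exp (2*w))"
  shows "(2 - q) / 3 \<le> p"
proof -
  \<comment> \<open>The two distances on the right add up to a multiple of
    \<open>cosh ((1 - q) * w)\<close>; cancel \<open>4 * sinh w\<close> and take logarithms.\<close>
  have key: "ln (cosh w) + q / p * ln (cosh (p * w))
      \<le> ln (cosh ((1 - q) * w)) + q / p * ln (cosh (2 * p * w))" if w: "0 < w" for w
  proof -
    define C where "C = cosh (p * w) powr (q / p)"
    define C2 where "C2 = cosh (2 * p * w) powr (q / p)"
    have C: "C > 0" "C2 > 0" by (simp_all add: C_def C2_def)
    have e: "pos_rel_dist p q (exp (-2*w)) (exp (2*w)) = 4 * sinh w * cosh w / C2"
      "pos_rel_dist p q (exp (-2*w)) 1 = 2 * exp (-((1 - q) * w)) * sinh w / C"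
      "pos_rel_dist p q 1 (exp (2*w)) = 2 * exp ((1 - q) * w) * sinh w / C"
      using pos_rel_dist_exp[of p q "-2*w" "2*w"] pos_rel_dist_exp[of p q "-2*w" 0]
        pos_rel_dist_exp[of p q 0 "2*w"] sinh_double[of w] p
      by (simp_all add: C_def C2_def mult_ac)
    have "4 * sinh w * cosh w / C2 \<le> 4 * sinh w * cosh ((1 - q) * w) / C"
      using tri[OF w] unfolding e by (simp add: cosh_field_def add_divide_distrib algebra_simps)
    then have "cosh w * C \<le> cosh ((1 - q) * w) * C2"
      using C w by (simp add: divide_simps mult_ac)
    then have "ln (cosh w * C) \<le> ln (cosh ((1 - q) * w) * C2)"
      using C by simp
    then show ?thesis
      using C by (simp add: ln_mult) (simp add: C_def C2_def ln_powr)
  qed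
  note lim = ln_cosh_over_square_tendsto
  \<comment> \<open>Coefficients of \<open>w\<^sup>2\<close> on both sides of
    \<open>key\<close>.\<close>
  have "1\<^sup>2 / 2 + q / p * (p\<^sup>2 / 2) \<le> (1 - q)\<^sup>2 / 2 + q / p * ((2 * p)\<^sup>2 / 2)"
  proof (rule tendsto_le[OF _ tendsto_add[OF lim tendsto_mult_left[OF lim]]
        tendsto_add[OF lim tendsto_mult_left[OF lim]]])
    show "\<forall>\<^sub>F w in at_right 0. ln (cosh (1 * w)) / w\<^sup>2 + q / p * (ln (cosh (p * w)) / w\<^sup>2)
      \<le> ln (cosh ((1 - q) * w)) / w\<^sup>2 + q / p * (ln (cosh (2 * p * w)) / w\<^sup>2)"
      using eventually_at_right_less
    proof eventually_elim
      case (elim w)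
      then show ?case
        using divide_right_mono[OF key[OF elim], of "w\<^sup>2"] by (simp add: add_divide_distrib)
    qed
  qed simp
  then have "q * (2 - q) \<le> q * (3 * p)"
    using p by (simp add: field_simps power2_eq_square)
  then show ?thesis using q by simp
qed

subsection \<open>Power means and relative distances\<close>

lemma power_mean_commute: "power_mean p x y = power_mean p y x"
  by (auto simp: power_mean_def Let_def max.commute min.commute mult.commute add.commute)

lemma power_mean_real:
  "0 < p \<Longrightarrow> power_mean (ereal p) x y = ((x powr p + y powr p) / 2) powr (1 / p)"
  by (simp add: power_mean_def)

lemma power_mean_infinity: "power_mean \<infinity> x y = max x y"
  by (simp add: power_mean_def)

lemma ereal_pos_cases:
  fixes p :: ereal
  assumes "0 < p"
  obtains "p = \<infinity>" | r where "p = ereal r" "0 < r"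
  using assms by (cases p) auto

lemma power_mean_pos:
  assumes "0 < p" "0 \<le> a" "0 < b"
  shows "0 < power_mean p a b"
  using assms(1)
proof (cases rule: ereal_pos_cases)
  case 1
  then show ?thesis using assms by (simp add: power_mean_infinity)
next
  case (2 r)
  have "0 < a powr r + b powr r" using assms by (intro add_nonneg_pos) auto
  then show ?thesis using 2 by (simp add: power_mean_real)
qed

lemma power_mean_mono:
  assumes "0 < p" "0 \<le> a" "0 \<le> b" "b \<le> c"
  shows "power_mean p a b \<le> power_mean p a c"
  using assms(1)
proof (cases rule: ereal_pos_cases)
  case 1
  then show ?thesis using assms by (auto simp: power_mean_infinity)
next
  case (2 r)
  then show ?thesis using assms by (auto simp: power_mean_real intro!: powr_mono2 divide_right_mono add_left_mono)
qed

text \<open>By homogeneity \<open>power_mean p a b / b\<close> is the mean of \<open>a / b\<close>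
  and 1, which decreases in \<open>b\<close>.\<close>

lemma power_mean_quotient_antimono:
  assumes "0 < p" "0 \<le> a" "0 < b" "b \<le> c"
  shows "power_mean p a c * b \<le> power_mean p a b * c"
  using assms(1)
proof (cases rule: ereal_pos_cases)
  case 1
  then show ?thesis
    using assms mult_mono[of a "max a b" b c] by (auto simp: power_mean_infinity max_def)
next
  case (2 r)
  have "b powr r \<le> c powr r" using assms 2 by (intro powr_mono2) auto
  then have "a powr r * b powr r \<le> a powr r * c powr r"
    by (simp add: mult_left_mono)
  then have "(a powr r + c powr r) / 2 * b powr r \<le> (a powr r + b powr r) / 2 * c powr r"
    by (simp add: algebra_simps)
  then have "((a powr r + c powr r) / 2 * b powr r) powr (1 / r)
      \<le> ((a powr r + b powr r) / 2 * c powr r) powr (1 / r)"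
    using 2 by (intro powr_mono2) auto
  moreover have "(x * y powr r) powr (1 / r) = x powr (1 / r) * y" if "0 \<le> x" "0 < y" for x y
    using that 2 by (simp add: powr_mult powr_powr)
  ultimately show ?thesis
    using 2 assms by (simp add: power_mean_real del: times_divide_eq_left)
qed

text \<open>The quotient of the \<open>q\<close>-th power by \<open>b\<close> is
  \<open>(power_mean p a b / b) powr q\<close> times \<open>b powr (q - 1)\<close>; neither factor
  increases with \<open>b\<close>, the second because \<open>q \<le> 1\<close>.\<close>

lemma power_mean_powr_quotient_antimono:
  assumes "0 < p" "0 \<le> a" "0 < b" "b \<le> c" and q: "0 < q" "q \<le> 1"
  shows "power_mean p a c powr q * b \<le> power_mean p a b powr q * c"
proof -
  have pos: "0 < power_mean p a b" "0 < power_mean p a c"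
    using assms by (auto intro: power_mean_pos)
  have "(power_mean p a c * b) powr q \<le> (power_mean p a b * c) powr q"
    using assms pos by (intro powr_mono2 power_mean_quotient_antimono) auto
  then have "power_mean p a c powr q * b powr q \<le> power_mean p a b powr q * c powr q"
    using assms pos by (simp add: powr_mult)
  moreover have "b powr (1 - q) \<le> c powr (1 - q)" using assms by (intro powr_mono2) auto
  ultimately have "power_mean p a c powr q * b powr q * b powr (1 - q)
      \<le> power_mean p a b powr q * c powr q * c powr (1 - q)"
    by (rule mult_mono) auto
  moreover have "b powr q * b powr (1 - q) = b" "c powr q * c powr (1 - q) = c"
    using assms by (simp_all flip: powr_add)
  ultimately show ?thesis by (simp only: mult.assoc)
qed

text \<open>Where the distance is infinite, both sides are the junk value 0.\<close>
lemma real_of_rel_dist: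
  "real_of_ereal (rel_dist p q x y) = norm (x - y) / power_mean p (norm x) (norm y) powr q"
  by (simp add: rel_dist_def Let_def powr_minus divide_inverse)

definition line_dist :: "ereal \<Rightarrow> real \<Rightarrow> real \<Rightarrow> real \<Rightarrow> real" where
  "line_dist p q s t = \<bar>s - t\<bar> / power_mean p \<bar>s\<bar> \<bar>t\<bar> powr q"

lemma line_dist_eq_pos_rel_dist:
  "0 < p \<Longrightarrow> 0 \<le> s \<Longrightarrow> s \<le> t \<Longrightarrow> line_dist (ereal p) q s t = pos_rel_dist p q s t"
  by (simp add: line_dist_def pos_rel_dist_def power_mean_real powr_powr)

lemma line_dist_triangle:
  assumes q: "0 < q" "q \<le> 1" and p: "ereal (max (1 - q) ((2 - q) / 3)) \<le> p"
    and abc: "0 \<le> a" "a < c" "c < b"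
  shows "line_dist p q a b \<le> line_dist p q a c + line_dist p q c b"
proof (cases "p = \<infinity>")
  case True
  \<comment> \<open>The maximum is the right endpoint, so only the piece from \<open>a\<close> to
    \<open>c\<close> changes its denominator.\<close>
  have "c - a \<le> (c - a) / c powr q * b powr q"
  proof -
    have "c powr q \<le> b powr q" using abc q by (intro powr_mono2) auto
    then show ?thesis using abc by (simp add: pos_le_divide_eq)
  qed
  then have "(c - a) / b powr q \<le> (c - a) / c powr q"
    using abc by (simp add: pos_divide_le_eq)
  moreover have "(b - a) / b powr q = (c - a) / b powr q + (b - c) / b powr q"
    by (simp flip: add_divide_distrib)
  ultimately show ?thesis
    using True abc by (simp add: line_dist_def power_mean_infinity)
next
  case False
  then obtain r where r: "p = ereal r" using p by (cases p) (auto simp del: ereal_max)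
  then have "1 - q \<le> r" "(2 - q) / 3 \<le> r" using p by auto
  moreover from this have "0 < r" using q by (simp add: pos_divide_le_eq)
  ultimately show ?thesis
    using pos_rel_dist_triangle[of q r a c b] abc q by (simp add: r line_dist_eq_pos_rel_dist)
qed

section \<open>Sufficiency in all dimensions\<close>

lemma rel_dist_is_metric:
  fixes p :: ereal
  assumes q: "0 < q" "q \<le> 1" and p: "ereal (max (1 - q) ((2 - q) / 3)) \<le> p"
  shows "is_finite_metric (rel_dist p q :: real ^ 'n \<Rightarrow> real ^ 'n \<Rightarrow> ereal)"
proof -
  have "(0::real) < (2 - q) / 3" using q by simp
  then have "ereal 0 < ereal (max (1 - q) ((2 - q) / 3))" unfolding ereal_less_eq less_ereal.simps by linarith
  then have p0: "0 < p" using p by (metis less_le_trans zero_ereal_def)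
  have pos: "0 < power_mean p (norm x) (norm y)" if "x \<noteq> 0 \<or> y \<noteq> 0" for x y :: "real ^ 'n"
    using that power_mean_pos[OF p0, of "norm x" "norm y"] power_mean_pos[OF p0, of "norm y" "norm x"]
    by (auto simp: power_mean_commute)
  have "\<bar>rel_dist p q x y\<bar> \<noteq> \<infinity>" for x y :: "real ^ 'n"
    using pos[of x y] q by (cases "x = 0 \<and> y = 0") (auto simp: rel_dist_def Let_def)
  moreover have "Metric_space UNIV (\<lambda>x y :: real ^ 'n. real_of_ereal (rel_dist p q x y))"
    unfolding real_of_rel_dist
  proof
    fix x y :: "real ^ 'n"
    show "norm (x - y) / power_mean p (norm x) (norm y) powr q
        = norm (y - x) / power_mean p (norm y) (norm x) powr q"
      by (simp add: norm_minus_commute power_mean_commute)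
    show "norm (x - y) / power_mean p (norm x) (norm y) powr q = 0 \<longleftrightarrow> x = y"
      using pos[of x y] by (cases "x = 0 \<and> y = 0") auto
  next
    fix x y z :: "real ^ 'n"
    show "norm (x - z) / power_mean p (norm x) (norm z) powr q
      \<le> norm (x - y) / power_mean p (norm x) (norm y) powr q
        + norm (y - z) / power_mean p (norm y) (norm z) powr q"
    proof (rule relative_triangle[where M = "\<lambda>a b. power_mean p a b powr q"])
      fix a b c :: real
      show "power_mean p a b powr q = power_mean p b a powr q"
        by (simp add: power_mean_commute)
      show "0 < power_mean p a b powr q" if "0 \<le> a" "0 < b"
        using power_mean_pos[OF p0 that] by simp
      show "power_mean p a b powr q \<le> power_mean p a c powr q" if "0 \<le> a" "0 \<le> b" "b \<le> c"
      proof (cases "b = 0 \<and> a = 0")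
        case True
        then have "power_mean p a b = 0"
          using p0 by (auto elim!: ereal_pos_cases simp: power_mean_real power_mean_infinity)
        then show ?thesis by simp
      next
        case False
        then have "0 < power_mean p a b"
          using that power_mean_pos[OF p0, of a b] power_mean_pos[OF p0, of b a]
          by (auto simp: power_mean_commute)
        then show ?thesis using that q by (intro powr_mono2 power_mean_mono p0) auto
      qed
      show "power_mean p a c powr q * b \<le> power_mean p a b powr q * c" if "0 \<le> a" "0 < b" "b \<le> c"
        by (rule power_mean_powr_quotient_antimono[OF p0 that q])
      show "(b - a) / power_mean p a b powr q
          \<le> (c - a) / power_mean p a c powr q + (b - c) / power_mean p c b powr q"
        if "0 \<le> a" "a < c" "c < b"
        using line_dist_triangle[OF q p that] that by (simp add: line_dist_def)
    qed
  qed simp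
  ultimately show ?thesis unfolding is_finite_metric_def by blast
qed

section \<open>Necessity by restriction to a line\<close>

lemma line_dist_metric:
  assumes "is_finite_metric (rel_dist p q :: real ^ 'n \<Rightarrow> real ^ 'n \<Rightarrow> ereal)"
  shows "Metric_space UNIV (line_dist p q)"
proof -
  \<comment> \<open>Any unit vector serves; \<open>undefined\<close> picks an arbitrary
    coordinate.\<close>
  define e :: "real ^ 'n" where "e = axis undefined 1"
  have e: "norm e = 1" by (simp add: e_def)
  then have "e \<noteq> 0" by auto
  interpret Metric_space UNIV "\<lambda>x y :: real ^ 'n. real_of_ereal (rel_dist p q x y)"
    using assms by (simp add: is_finite_metric_def)
  have eq: "line_dist p q s t = real_of_ereal (rel_dist p q (s *\<^sub>R e) (t *\<^sub>R e))" for s t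
    unfolding real_of_rel_dist line_dist_def by (simp add: e flip: scaleR_left_diff_distrib)
  show ?thesis
    unfolding eq using \<open>e \<noteq> 0\<close> by unfold_locales (auto simp: commute triangle)
qed

lemma line_dist_metric_conditions:
  assumes "q \<noteq> 0" "Metric_space UNIV (line_dist p q)"
  shows "0 < q \<and> q \<le> 1 \<and> ereal (max (1 - q) ((2 - q) / 3)) \<le> p"
proof -
  interpret Metric_space UNIV "line_dist p q" by fact
  note tri = triangle[OF UNIV_I UNIV_I UNIV_I]
  have p0: "0 < p"
  proof (rule ccontr)
    assume "\<not> 0 < p"
    \<comment> \<open>Division by zero then gives the distinct points 1 and 0 the distance 0 in
      \<open>line_dist\<close>.\<close>
    then have "power_mean p 1 0 = 0"
      by (cases p) (auto simp: power_mean_def)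
    then have "line_dist p q 1 0 = 0" by (simp add: line_dist_def)
    then show False by simp
  qed
  have q0: "0 < q"
  proof (rule ccontr)
    assume "\<not> 0 < q"
    then have q: "q < 0" using assms by simp
    from p0 show False
    proof (cases rule: ereal_pos_cases)
      case 1
      \<comment> \<open>For the maximum, the points -1, 0, 1 only give equality, hence 0, 1,
        2.\<close>
      have "2 * 2 powr (-q) \<le> 1 + 2 powr (-q)"
        using tri[of 0 2 1] 1 by (simp add: line_dist_def power_mean_infinity powr_minus divide_inverse)
      then have "2 powr (-q) \<le> 2 powr 0" by simp
      then show False using q by (subst (asm) powr_le_cancel_iff) auto
    next
      case (2 r)
      \<comment> \<open>The mean of 1 and 0 is below 1, so for negative \<open>q\<close> the detour
        through 0 is shorter.\<close>
      have "line_dist p q (-1) 1 = 2"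
        "line_dist p q (-1) 0 = (1 / 2) powr (- (q / r))"
        "line_dist p q 0 1 = (1 / 2) powr (- (q / r))"
        using 2 by (simp_all add: line_dist_def power_mean_real powr_powr powr_minus_divide)
      then have "2 \<le> 2 * (1 / 2) powr (- (q / r))"
        using tri[of "-1" 1 0] by simp
      moreover have "(1 / 2) powr (- (q / r)) < (1 powr (- (q / r)) :: real)"
        using q 2 by (intro powr_less_mono2) (auto simp: divide_neg_pos)
      ultimately show False by simp
    qed
  qed
  have q1: "q \<le> 1"
  proof (rule ccontr)
    assume "\<not> q \<le> 1"
    then have q: "q > 1" by simp
    \<comment> \<open>Chosen so that \<open>t powr (1 - q) = 4\<close>: then \<open>t\<close> is 4
      times as far from 0 as 1 is, while its distance to 1 is at most that of 1 to 0, so the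
      triangle inequality would give \<open>4 \<le> 2\<close>.\<close>
    define t where "t = 4 powr (1 / (1 - q))"
    define k where "k = power_mean p 1 0"
    have k: "0 < k" using power_mean_pos[OF p0, of 0 1] by (simp add: k_def power_mean_commute)
    have t: "0 < t" "t powr (1 - q) = 4" using q by (auto simp: t_def powr_powr)
    have "4 powr (1 / (1 - q)) < 4 powr (0::real)" using q by (subst powr_less_cancel_iff) auto
    then have t1: "t < 1" by (simp add: t_def)
    have "power_mean p t 0 = t * k"
      using p0 t by (cases rule: ereal_pos_cases)
        (auto simp: k_def power_mean_infinity power_mean_real powr_divide powr_powr powr_one)
    then have "line_dist p q t 0 = t / (t powr q * k powr q)"
      using t k by (simp add: line_dist_def powr_mult)
    also have "\<dots> = 4 / k powr q"
      using t by (simp flip: t(2) add: powr_diff)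
    finally have "line_dist p q t 0 = 4 / k powr q" .
    moreover have "line_dist p q 1 0 = 1 / k powr q"
      by (simp add: line_dist_def k_def)
    moreover have "line_dist p q t 1 \<le> 1 / k powr q"
    proof -
      have "k \<le> power_mean p t 1"
        using power_mean_mono[OF p0, of 1 0 t] t by (simp add: k_def power_mean_commute)
      then have "k powr q \<le> power_mean p t 1 powr q" using q k by (intro powr_mono2) auto
      then show ?thesis
        using t t1 k unfolding line_dist_def by (intro frac_le) auto
    qed
    ultimately have "4 / k powr q \<le> 2 / k powr q"
      using tri[of t 0 1] by simp
    then show False using k by (simp add: divide_le_cancel)
  qed
  from p0 have "ereal (max (1 - q) ((2 - q) / 3)) \<le> p"
  proof (cases rule: ereal_pos_cases)
    case (2 r)
    have "1 - q \<le> r"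
      by (rule pos_rel_dist_triangle_imp_first_exponent[OF 2(2) q0])
        (use tri 2 in \<open>simp flip: line_dist_eq_pos_rel_dist\<close>)
    moreover have "(2 - q) / 3 \<le> r"
      by (rule pos_rel_dist_triangle_imp_second_exponent[OF 2(2) q0])
        (use tri 2 in \<open>simp flip: line_dist_eq_pos_rel_dist\<close>)
    ultimately show ?thesis using 2 by simp
  qed simp
  with q0 q1 show ?thesis by simp
qed

theorem theorem1p1:
  fixes p :: ereal and q :: real
  assumes "q \<noteq> 0"
  shows "is_finite_metric (rel_dist p q :: real ^ 'n \<Rightarrow> real ^ 'n \<Rightarrow> ereal) \<longleftrightarrow>
         0 < q \<and> q \<le> 1 \<and> p \<ge> ereal (max (1 - q) ((2 - q) / 3))"
  using line_dist_metric_conditions[OF assms line_dist_metric] rel_dist_is_metric by blast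

end
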